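(* Let $(\mathcal{M},\boldsymbol{g})$ be a four-dimensional oriented space-time of signature $(+,-,-,-)$, let $\boldsymbol{F}\in\Omega^{2}(\mathcal{M})$ be a smooth 2-form which is regular at every point, and let $\tilde{\boldsymbol{g}}=-\kappa_g^{-1}\left(\boldsymbol{F}^{2_g}+\frac{\psi_g}{2}\boldsymbol{g}\right)$ be the disformal transform of $\boldsymbol{g}$ induced by $\boldsymbol{F}$ (a Lorentzian metric on $\mathcal{M}$ of signature $(+,-,-,-)$). If the pair of 2-forms $\boldsymbol{F},\ \star_{g}\boldsymbol{F}$ is closed under exterior derivation, i.e. $d\boldsymbol{F}=0$ and $d\star_{g}\boldsymbol{F}=0$, then the pair $\boldsymbol{F},\ \star_{\tilde g}\boldsymbol{F}$ is also closed, i.e. $d\boldsymbol{F}=0$ and $d\star_{\tilde g}\boldsymbol{F}=0$.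
   Context: Conventions. For a Lorentzian metric $\boldsymbol{h}$ of signature $(+,-,-,-)$ on the oriented 4-manifold $\mathcal{M}$, with $h=\det(h_{ab})$ in positively oriented coordinates and $[abcd]$ the Levi-Civita permutation symbol with $[0123]=1$, the Hodge dual of a 2-form $\boldsymbol{G}$ is $\star_{h}G_{ab}=\frac12\sqrt{-h}\,[abcd](h^{-1})^{cp}(h^{-1})^{dq}G_{pq}$ (the same orientation is used for all metrics), and the inner product of 2-forms is $\langle\boldsymbol{G},\boldsymbol{H}\rangle_h=\frac12(h^{-1})^{ac}(h^{-1})^{bd}G_{ab}H_{cd}$. Products are $[(\boldsymbol{A}\boldsymbol{B})_h]_{ab}=(h^{-1})^{cd}A_{ac}B_{db}$, so $(\boldsymbol{F}^{2_h})_{ab}=F_{ac}(h^{-1})^{cd}F_{db}$. Invariants of $\boldsymbol{F}$: $\psi_h=\langle\boldsymbol{F},\boldsymbol{F}\rangle_h$, $\phi_h=\langle\boldsymbol{F},\star_h\boldsymbol{F}\rangle_h$, $\kappa_h=\frac12\sqrt{\psi_h^2+\phi_h^2}$. $\boldsymbol{F}$ is regular (with respect to $\boldsymbol{g}$) if $\kappa_g\neq0$. The disformal transform of $\boldsymbol{g}$ induced by a regular $\boldsymbol{F}$ is defined pointwise by $\tilde{\boldsymbol{g}}=-\kappa_g^{-1}\left(\boldsymbol{F}^{2_g}+\frac{\psi_g}{2}\boldsymbol{g}\right)$; it is a symmetric non-degenerate tensor of signature $(+,-,-,-)$. *)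

theory Defs
  imports "HOL-Analysis.Analysis"
begin

text \<open>
  Smoothness of maps between normed spaces, only meant for open \<open>S\<close>: each step asks for
  differentiability and for the same property of all directional derivatives.
\<close>

fun Ck_on :: "nat \<Rightarrow> ('a::real_normed_vector \<Rightarrow> 'b::real_normed_vector) \<Rightarrow> 'a set \<Rightarrow> bool" where
  "Ck_on 0 f S \<longleftrightarrow> continuous_on S f"
| "Ck_on (Suc k) f S \<longleftrightarrow> (\<forall>x\<in>S. f differentiable (at x)) \<and>
     (\<forall>v. Ck_on k (\<lambda>x. frechet_derivative f (at x) v) S)"

definition smooth_on :: "('a::real_normed_vector \<Rightarrow> 'b::real_normed_vector) \<Rightarrow> 'a set \<Rightarrow> bool" where
  "smooth_on f S \<longleftrightarrow> (\<forall>k. Ck_on k f S)"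


section \<open>Pointwise algebra of 2-tensors in coordinates\<close>

text \<open>
  A covariant 2-tensor at a point is given by its components \<open>T $ a $ b\<close>.  In the
  type \<open>4\<close> the elements are 0, 1, 2, 3 (and \<open>4 = 0\<close>), which are the
  index values 0, 1, 2, 3.
\<close>

type_synonym mat4 = "real^4^4"

definition minkowski :: mat4 where
  "minkowski = (\<chi> a b. if a = b then (if a = 0 then 1 else -1) else 0)"

definition lorentzian_form :: "mat4 \<Rightarrow> bool" where
  "lorentzian_form h \<longleftrightarrow> transpose h = h \<and>
     (\<exists>P::mat4. invertible P \<and> transpose P ** h ** P = minkowski)"

definition alternating_form :: "mat4 \<Rightarrow> bool" where
  "alternating_form G \<longleftrightarrow> (\<forall>a b. G $ a $ b = - (G $ b $ a))"

definition levi_civita :: "4 \<Rightarrow> 4 \<Rightarrow> 4 \<Rightarrow> 4 \<Rightarrow> real" where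
  "levi_civita a b c d =
     (let \<sigma> = (\<lambda>i::4. if i = 0 then a else if i = 1 then b else if i = 2 then c else d)
      in if bij \<sigma> then of_int (sign \<sigma>) else 0)"

lemma levi_civita_0123: "levi_civita 0 1 2 3 = 1"
proof -
  have "i = 3" if "i \<noteq> 0" "i \<noteq> 1" "i \<noteq> 2" for i :: 4
    using exhaust_4[of i] that by auto
  then have "(\<lambda>i::4. if i = 0 then 0 else if i = 1 then 1 else if i = 2 then 2 else 3) = id"
    by fastforce
  then show ?thesis
    by (simp add: levi_civita_def sign_id)
qed

definition hodge :: "mat4 \<Rightarrow> mat4 \<Rightarrow> mat4" where
  "hodge h G = (\<chi> a b. 1/2 * sqrt (- det h) *
     (\<Sum>c\<in>UNIV. \<Sum>d\<in>UNIV. \<Sum>p\<in>UNIV. \<Sum>q\<in>UNIV.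
        levi_civita a b c d * matrix_inv h $ c $ p * matrix_inv h $ d $ q * G $ p $ q))"

definition inner2 :: "mat4 \<Rightarrow> mat4 \<Rightarrow> mat4 \<Rightarrow> real" where
  "inner2 h G H = 1/2 *
     (\<Sum>a\<in>UNIV. \<Sum>b\<in>UNIV. \<Sum>c\<in>UNIV. \<Sum>d\<in>UNIV.
        matrix_inv h $ a $ c * matrix_inv h $ b $ d * G $ a $ b * H $ c $ d)"

definition tensor_prod :: "mat4 \<Rightarrow> mat4 \<Rightarrow> mat4 \<Rightarrow> mat4" where
  "tensor_prod h A B = (\<chi> a b. \<Sum>c\<in>UNIV. \<Sum>d\<in>UNIV.
     matrix_inv h $ c $ d * A $ a $ c * B $ d $ b)"

definition inv_psi :: "mat4 \<Rightarrow> mat4 \<Rightarrow> real" where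
  "inv_psi h F = inner2 h F F"

definition inv_phi :: "mat4 \<Rightarrow> mat4 \<Rightarrow> real" where
  "inv_phi h F = inner2 h F (hodge h F)"

definition inv_kappa :: "mat4 \<Rightarrow> mat4 \<Rightarrow> real" where
  "inv_kappa h F = 1/2 * sqrt ((inv_psi h F)\<^sup>2 + (inv_phi h F)\<^sup>2)"

definition disformal :: "mat4 \<Rightarrow> mat4 \<Rightarrow> mat4" where
  "disformal g F =
     - (inverse (inv_kappa g F) *\<^sub>R (tensor_prod g F F + (inv_psi g F / 2) *\<^sub>R g))"


section \<open>Oriented smooth 4-manifolds\<close>

text \<open>
  A chart is a pair of its domain and its coordinate map; only the values of the map on the
  domain matter.
\<close>

type_synonym 'a chart = "'a set \<times> ('a \<Rightarrow> real^4)"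

abbreviation chart_dom :: "'a chart \<Rightarrow> 'a set" where "chart_dom \<equiv> fst"
abbreviation chart_map :: "'a chart \<Rightarrow> 'a \<Rightarrow> real^4" where "chart_map \<equiv> snd"

definition chart_image :: "'a chart \<Rightarrow> (real^4) set" where
  "chart_image c = chart_map c ` chart_dom c"

definition chart_inv :: "'a chart \<Rightarrow> real^4 \<Rightarrow> 'a" where
  "chart_inv c = inv_into (chart_dom c) (chart_map c)"

definition is_chart :: "'a topology \<Rightarrow> 'a chart \<Rightarrow> bool" where
  "is_chart M c \<longleftrightarrow> openin M (chart_dom c) \<and> open (chart_image c) \<and>
     homeomorphic_map (subtopology M (chart_dom c)) (top_of_set (chart_image c)) (chart_map c)"

definition transition :: "'a chart \<Rightarrow> 'a chart \<Rightarrow> real^4 \<Rightarrow> real^4" where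
  "transition c c' = chart_map c' \<circ> chart_inv c"

text \<open>
  The orientation is carried by the atlas: all its charts are positively oriented.
  The atlas need not be maximal.
\<close>

definition oriented_atlas :: "'a topology \<Rightarrow> 'a chart set \<Rightarrow> bool" where
  "oriented_atlas M \<A> \<longleftrightarrow>
     (\<forall>c\<in>\<A>. is_chart M c) \<and> \<Union> (chart_dom ` \<A>) = topspace M \<and>
     (\<forall>c\<in>\<A>. \<forall>c'\<in>\<A>.
        smooth_on (transition c c') (chart_map c ` (chart_dom c \<inter> chart_dom c')) \<and>
        (\<forall>p \<in> chart_dom c \<inter> chart_dom c'.
           det (jacobian (transition c c') (at (chart_map c p))) > 0))"

definition oriented_4_manifold :: "'a topology \<Rightarrow> 'a chart set \<Rightarrow> bool" where
  "oriented_4_manifold M \<A> \<longleftrightarrow>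
     Hausdorff_space M \<and> second_countable M \<and> oriented_atlas M \<A>"


section \<open>Tensor fields, Lorentzian metrics and 2-forms\<close>

text \<open>
  \<open>T c p $ a $ b\<close> is the \<open>(a, b)\<close> component, in the chart \<open>c\<close>, of
  the tensor field at the point \<open>p\<close> of the domain of \<open>c\<close>.  The matrix identity
  below is the transformation law for covariant 2-tensors, since the \<open>(i, a)\<close>
  entry of the Jacobian is the derivative of the \<open>i\<close>-th new coordinate with respect to the
  \<open>a\<close>-th old one.
\<close>

type_synonym 'a field2 = "'a chart \<Rightarrow> 'a \<Rightarrow> mat4"

definition smooth_tensor2 :: "'a chart set \<Rightarrow> 'a field2 \<Rightarrow> bool" where
  "smooth_tensor2 \<A> T \<longleftrightarrow>
     (\<forall>c\<in>\<A>. \<forall>c'\<in>\<A>. \<forall>p \<in> chart_dom c \<inter> chart_dom c'.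
        let J = jacobian (transition c c') (at (chart_map c p))
        in T c p = transpose J ** T c' p ** J) \<and>
     (\<forall>c\<in>\<A>. smooth_on (\<lambda>x. T c (chart_inv c x)) (chart_image c))"

definition lorentzian_metric :: "'a chart set \<Rightarrow> 'a field2 \<Rightarrow> bool" where
  "lorentzian_metric \<A> g \<longleftrightarrow> smooth_tensor2 \<A> g \<and>
     (\<forall>c\<in>\<A>. \<forall>p\<in>chart_dom c. lorentzian_form (g c p))"

definition two_form :: "'a chart set \<Rightarrow> 'a field2 \<Rightarrow> bool" where
  "two_form \<A> F \<longleftrightarrow> smooth_tensor2 \<A> F \<and>
     (\<forall>c\<in>\<A>. \<forall>p\<in>chart_dom c. alternating_form (F c p))"

definition regular_form :: "'a chart set \<Rightarrow> 'a field2 \<Rightarrow> 'a field2 \<Rightarrow> bool" where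
  "regular_form \<A> g F \<longleftrightarrow> (\<forall>c\<in>\<A>. \<forall>p\<in>chart_dom c. inv_kappa (g c p) (F c p) \<noteq> 0)"

definition hodge_field :: "'a field2 \<Rightarrow> 'a field2 \<Rightarrow> 'a field2" where
  "hodge_field h G = (\<lambda>c p. hodge (h c p) (G c p))"

definition disformal_field :: "'a field2 \<Rightarrow> 'a field2 \<Rightarrow> 'a field2" where
  "disformal_field g F = (\<lambda>c p. disformal (g c p) (F c p))"

definition coord_deriv :: "'a chart \<Rightarrow> 4 \<Rightarrow> ('a \<Rightarrow> real) \<Rightarrow> 'a \<Rightarrow> real" where
  "coord_deriv c a f p =
     frechet_derivative (f \<circ> chart_inv c) (at (chart_map c p)) (axis a 1)"

text \<open>The components of the exterior derivative of a 2-form in the chart \<open>c\<close>.\<close>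

definition ext_deriv :: "'a field2 \<Rightarrow> 'a chart \<Rightarrow> 'a \<Rightarrow> 4 \<Rightarrow> 4 \<Rightarrow> 4 \<Rightarrow> real" where
  "ext_deriv G c p i j k =
     coord_deriv c i (\<lambda>q. G c q $ j $ k) p
   + coord_deriv c j (\<lambda>q. G c q $ k $ i) p
   + coord_deriv c k (\<lambda>q. G c q $ i $ j) p"

definition closed_form :: "'a chart set \<Rightarrow> 'a field2 \<Rightarrow> bool" where
  "closed_form \<A> G \<longleftrightarrow>
     (\<forall>c\<in>\<A>. \<forall>p\<in>chart_dom c. \<forall>i j k. ext_deriv G c p i j k = 0)"

end

theory Submission
  imports Defs
begin

text \<open>
  The dual \<open>\<star>\<^sub>g F\<close> itself does not change under the disformal transform, pointwise.
  Put \<open>A = g\<^sup>-\<^sup>1 F\<close>.  Then \<open>disformal g F = g B\<close> with \<open>B = - (A\<^sup>2 + \<psi>/2) / \<kappa>\<close>.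
  The characteristic polynomial of \<open>A\<close>, namely \<open>A\<^sup>4 + \<psi> A\<^sup>2 = \<phi>\<^sup>2/4\<close>, gives \<open>B\<^sup>2 = 1\<close>,
  and since \<open>tr A\<^sup>2 = -2\<psi>\<close> the involution \<open>B\<close> is traceless, so \<open>det B = 1\<close>.
  As \<open>B\<close> commutes with \<open>A\<close>, raising both indices of \<open>F\<close> with \<open>g B\<close> gives
  \<open>B A B g\<^sup>-\<^sup>1 = A g\<^sup>-\<^sup>1\<close>, the same as with \<open>g\<close>, and the volume elements agree.
\<close>

section \<open>Determinants and the Levi-Civita symbol in dimension 4\<close>

lemma det_4:
  fixes A :: "'a::comm_ring_1^4^4"
  shows "det A =
    A$1$1 * (A$2$2 * A$3$3 * A$4$4 + A$2$3 * A$3$4 * A$4$2 + A$2$4 * A$3$2 * A$4$3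
           - A$2$2 * A$3$4 * A$4$3 - A$2$3 * A$3$2 * A$4$4 - A$2$4 * A$3$3 * A$4$2)
  - A$1$2 * (A$2$1 * A$3$3 * A$4$4 + A$2$3 * A$3$4 * A$4$1 + A$2$4 * A$3$1 * A$4$3
           - A$2$1 * A$3$4 * A$4$3 - A$2$3 * A$3$1 * A$4$4 - A$2$4 * A$3$3 * A$4$1)
  + A$1$3 * (A$2$1 * A$3$2 * A$4$4 + A$2$2 * A$3$4 * A$4$1 + A$2$4 * A$3$1 * A$4$2
           - A$2$1 * A$3$4 * A$4$2 - A$2$2 * A$3$1 * A$4$4 - A$2$4 * A$3$2 * A$4$1)
  - A$1$4 * (A$2$1 * A$3$2 * A$4$3 + A$2$2 * A$3$3 * A$4$1 + A$2$3 * A$3$1 * A$4$2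
           - A$2$1 * A$3$3 * A$4$2 - A$2$2 * A$3$1 * A$4$3 - A$2$3 * A$3$2 * A$4$1)"
proof -
  have f1: "finite {2::4, 3, 4}" "1 \<notin> {2::4, 3, 4}"
    and f2: "finite {3::4, 4}" "2 \<notin> {3::4, 4}"
    and f3: "finite {4::4}" "3 \<notin> {4::4}" by auto
  show ?thesis
    unfolding det_def UNIV_4
    unfolding sum_over_permutations_insert[OF f1]
    unfolding sum_over_permutations_insert[OF f2]
    unfolding sum_over_permutations_insert[OF f3]
    unfolding permutes_sing
    by (simp add: sign_swap_id permutation_swap_id sign_compose permutation_compose sign_id
        algebra_simps)
qed

text \<open>Unit-vector rows let \<open>det_4\<close> evaluate the symbol without computing
  \<open>sign\<close>. A bijective \<sigma> permutes the rows of the identity; otherwise two rows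
  coincide.\<close>

lemma levi_civita_eq_det:
  "levi_civita a b c d =
     det (\<chi> i::4. axis (if i = 0 then a else if i = 1 then b else if i = 2 then c else d) 1)"
proof -
  define \<sigma> where "\<sigma> = (\<lambda>i::4. if i = 0 then a else if i = 1 then b else if i = 2 then c else d)"
  have "(if bij \<sigma> then of_int (sign \<sigma>) else 0) = det (\<chi> i. axis (\<sigma> i) (1::real))"
  proof (cases "bij \<sigma>")
    case True
    then have "\<sigma> permutes UNIV" by (simp add: permutes_def bij_iff)
    then have "det (\<chi> i. (mat 1 :: real^4^4) $ \<sigma> i) = of_int (sign \<sigma>) * det (mat 1 :: real^4^4)"
      by (rule det_permute_rows)
    moreover have "(\<chi> i. (mat 1 :: real^4^4) $ \<sigma> i) = (\<chi> i. axis (\<sigma> i) 1)"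
      by (auto simp: mat_def axis_def vec_eq_iff)
    ultimately show ?thesis using True by simp
  next
    case False
    then have "\<not> inj \<sigma>" by (simp add: bij_def finite_UNIV_inj_surj)
    then obtain i j where "i \<noteq> j" "\<sigma> i = \<sigma> j" by (auto simp: inj_def)
    then have "det (\<chi> i. axis (\<sigma> i) (1::real)) = 0"
      by (intro det_identical_rows[of i j]) (auto simp: row_def)
    with False show ?thesis by simp
  qed
  then show ?thesis by (simp only: levi_civita_def \<sigma>_def Let_def)
qed

text \<open>Expansions such as \<open>det_4\<close> index by 1, 2, 3, 4, tensor components by 0, 1,
  2, 3; the time index 0 comes last in the former.\<close>

lemma four_eq_0: "(4::4) = 0" by simp

lemma sum_UNIV_4: "sum f (UNIV :: 4 set) = f 0 + f 1 + f 2 + f 3"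
  by (simp add: sum_4 four_eq_0 ac_simps)

lemma all_4: "(\<forall>i::4. P i) \<longleftrightarrow> P 0 \<and> P 1 \<and> P 2 \<and> P 3"
  by (auto simp: forall_4 four_eq_0)

section \<open>Pfaffians and duals of alternating matrices\<close>

definition pfaffian4 :: "'a::comm_ring_1^4^4 \<Rightarrow> 'a" where
  "pfaffian4 X = X$0$1 * X$2$3 - X$0$2 * X$1$3 + X$0$3 * X$1$2"

lemma alternating_form_nth:
  assumes "alternating_form X"
  shows "X$1$0 = - X$0$1" "X$2$0 = - X$0$2" "X$3$0 = - X$0$3" "X$2$1 = - X$1$2"
    "X$3$1 = - X$1$3" "X$3$2 = - X$2$3" "X$0$0 = 0" "X$1$1 = 0" "X$2$2 = 0" "X$3$3 = 0"
proof -
  have skew: "X$a$b = - X$b$a" for a b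
    using assms unfolding alternating_form_def by blast
  have diag: "X$a$a = 0" for a
    using skew[of a a] by simp
  show "X$1$0 = - X$0$1" "X$2$0 = - X$0$2" "X$3$0 = - X$0$3" "X$2$1 = - X$1$2"
    "X$3$1 = - X$1$3" "X$3$2 = - X$2$3" by (rule skew)+
  show "X$0$0 = 0" "X$1$1 = 0" "X$2$2 = 0" "X$3$3 = 0" by (rule diag)+
qed

text \<open>The Pfaffian is half the coefficient of the 4-form X wedge X, and pullback by
  \<open>M\<close> multiplies a 4-form by \<open>det M\<close>.\<close>

lemma pfaffian4_congruence:
  fixes X M :: mat4
  assumes "alternating_form X"
  shows "pfaffian4 (transpose M ** X ** M) = det M * pfaffian4 X"
proof -
  note X = alternating_form_nth[OF assms]
  \<comment> \<open>These minors form the second compound matrix of \<open>M\<close>, through which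
    the pullback acts on 2-forms.\<close>
  define m where "m p q a b = M$p$a * M$q$b - M$q$a * M$p$b" for p q a b
  define w where "w p q r s = m p q 0 1 * m r s 2 3 - m p q 0 2 * m r s 1 3 + m p q 0 3 * m r s 1 2
    + m p q 2 3 * m r s 0 1 - m p q 1 3 * m r s 0 2 + m p q 1 2 * m r s 0 3" for p q r s
  have entry: "(transpose M ** X ** M)$a$b = X$0$1 * m 0 1 a b + X$0$2 * m 0 2 a b
      + X$0$3 * m 0 3 a b + X$1$2 * m 1 2 a b + X$1$3 * m 1 3 a b + X$2$3 * m 2 3 a b" for a b
    by (simp add: matrix_matrix_mult_def transpose_def sum_UNIV_4 X m_def algebra_simps)
  (* w p q r s is the determinant with rows p, q, r, s of M, in Laplace expansion. *)
  have w0: "w p q p s = 0" "w p q s q = 0" "w p q q s = 0" for p q s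
    by (simp_all add: w_def m_def algebra_simps)
  have w1: "w 0 1 2 3 = det M" "w 0 2 1 3 = - det M" "w 0 3 1 2 = det M"
    by (simp_all add: w_def m_def det_4 four_eq_0 algebra_simps)
  \<comment> \<open>Doubling symmetrises the quadratic form in the entries of \<open>X\<close>, with
    coefficients \<open>w\<close>; only the three splittings of 0, 1, 2, 3 into two pairs
    survive.\<close>
  have "2 * pfaffian4 (transpose M ** X ** M) =
      X$0$1 * X$0$1 * w 0 1 0 1 + X$0$2 * X$0$2 * w 0 2 0 2 + X$0$3 * X$0$3 * w 0 3 0 3
    + X$1$2 * X$1$2 * w 1 2 1 2 + X$1$3 * X$1$3 * w 1 3 1 3 + X$2$3 * X$2$3 * w 2 3 2 3
    + 2 * (X$0$1 * X$0$2 * w 0 1 0 2 + X$0$1 * X$0$3 * w 0 1 0 3 + X$0$1 * X$1$2 * w 0 1 1 2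
    + X$0$1 * X$1$3 * w 0 1 1 3 + X$0$1 * X$2$3 * w 0 1 2 3 + X$0$2 * X$0$3 * w 0 2 0 3
    + X$0$2 * X$1$2 * w 0 2 1 2 + X$0$2 * X$1$3 * w 0 2 1 3 + X$0$2 * X$2$3 * w 0 2 2 3
    + X$0$3 * X$1$2 * w 0 3 1 2 + X$0$3 * X$1$3 * w 0 3 1 3 + X$0$3 * X$2$3 * w 0 3 2 3
    + X$1$2 * X$1$3 * w 1 2 1 3 + X$1$2 * X$2$3 * w 1 2 2 3 + X$1$3 * X$2$3 * w 1 3 2 3)"
    unfolding pfaffian4_def entry w_def by (simp add: algebra_simps)
  also have "\<dots> = 2 * (det M * pfaffian4 X)"
    unfolding w0 w1 by (simp add: pfaffian4_def algebra_simps)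
  finally show ?thesis by simp
qed

text \<open>The Hodge star stripped of the metric: the indices count as already raised and the
  volume factor is left out.\<close>

definition dual4 :: "mat4 \<Rightarrow> mat4" where
  "dual4 X = (\<chi> a b. 1/2 * (\<Sum>c\<in>UNIV. \<Sum>d\<in>UNIV. levi_civita a b c d * X$c$d))"

lemma dual4_nth:
  assumes "alternating_form X"
  shows "dual4 X$0$1 = X$2$3" "dual4 X$0$2 = - X$1$3" "dual4 X$0$3 = X$1$2"
    "dual4 X$1$2 = X$0$3" "dual4 X$1$3 = - X$0$2" "dual4 X$2$3 = X$0$1"
    "dual4 X$1$0 = - X$2$3" "dual4 X$2$0 = X$1$3" "dual4 X$3$0 = - X$1$2"
    "dual4 X$2$1 = - X$0$3" "dual4 X$3$1 = X$0$2" "dual4 X$3$2 = - X$0$1"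
    "dual4 X$0$0 = 0" "dual4 X$1$1 = 0" "dual4 X$2$2 = 0" "dual4 X$3$3 = 0"
  using alternating_form_nth[OF assms]
  by (simp_all add: dual4_def sum_UNIV_4 levi_civita_eq_det det_4 four_eq_0 axis_def)

text \<open>Up to sign, \<open>dual4 X\<close> is the Pfaffian analogue of the adjugate:
  off-diagonal terms cancel in pairs.\<close>

lemma mult_dual4_self:
  assumes "alternating_form X"
  shows "X ** dual4 X = (- pfaffian4 X) *\<^sub>R mat 1"
  using alternating_form_nth[OF assms] dual4_nth[OF assms]
  by (simp add: vec_eq_iff all_4 matrix_matrix_mult_def mat_def sum_UNIV_4 pfaffian4_def algebra_simps)

text \<open>Contracting two Levi-Civita symbols over one index leaves antisymmetrised Kronecker
  deltas, whence the trace term and the reversed factors.\<close>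

lemma dual4_mult_dual4:
  assumes "alternating_form X" "alternating_form F"
  shows "dual4 F ** dual4 X = (trace (X ** F) / 2) *\<^sub>R mat 1 - X ** F"
  using alternating_form_nth[OF assms(1)] dual4_nth[OF assms(1)]
    alternating_form_nth[OF assms(2)] dual4_nth[OF assms(2)]
  by (simp add: vec_eq_iff all_4 trace_def matrix_matrix_mult_def mat_def sum_UNIV_4 algebra_simps)

lemma alternating_form_iff: "alternating_form G \<longleftrightarrow> transpose G = - G"
  unfolding alternating_form_def vec_eq_iff transpose_def by (simp; metis)

lemma matrix_add_rdistrib: "((A :: 'a::semiring_1^'n^'m) + B) ** C = A ** C + B ** C"
  by (simp add: matrix_matrix_mult_def vec_eq_iff sum.distrib distrib_right)

lemma matrix_mult_minus_left: "(- A) ** B = - (A ** (B :: 'a::ring_1^'n^'m))"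
  by (simp add: matrix_matrix_mult_def vec_eq_iff sum_negf)

lemma matrix_mult_minus_right: "A ** (- B) = - (A ** (B :: 'a::ring_1^'n^'m))"
  by (simp add: matrix_matrix_mult_def vec_eq_iff sum_negf)

lemma matrix_sub_ldistrib: "A ** (B - C) = A ** B - A ** (C :: 'a::ring_1^'n^'m)"
  by (simp add: matrix_matrix_mult_def vec_eq_iff sum_subtractf right_diff_distrib)

text \<open>\<open>X ** F ** dual4 F ** dual4 X\<close> is evaluated twice: from the inside out by
  \<open>mult_dual4_self\<close>, giving a scalar, and with its last two factors combined by
  \<open>dual4_mult_dual4\<close>.\<close>

lemma alternating_prod_square:
  assumes "alternating_form X" "alternating_form F"
  shows "(X ** F) ** (X ** F) =
    (trace (X ** F) / 2) *\<^sub>R (X ** F) - (pfaffian4 X * pfaffian4 F) *\<^sub>R mat 1"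
proof -
  have "X ** F ** (dual4 F ** dual4 X) = X ** (F ** dual4 F) ** dual4 X"
    by (simp only: matrix_mul_assoc)
  also have "\<dots> = (pfaffian4 X * pfaffian4 F) *\<^sub>R mat 1"
    by (simp add: mult_dual4_self assms matrix_scalar_ac matrix_mult_minus_left
        matrix_mult_minus_right mult.commute flip: scalar_matrix_assoc)
  finally show ?thesis
    by (simp add: dual4_mult_dual4[OF assms] matrix_sub_ldistrib matrix_scalar_ac)
      (simp add: algebra_simps)
qed

lemma alternating_form_congruence:
  assumes "alternating_form G"
  shows "alternating_form (P ** G ** transpose P)"
  using assms
  by (simp add: alternating_form_iff matrix_transpose_mul matrix_mul_assoc
      matrix_mult_minus_left matrix_mult_minus_right)

section \<open>Index contractions as matrix products; determinants of involutions\<close>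

lemma matrix_inv_unique:
  fixes A B :: "'a::field^'n^'n"
  assumes "A ** B = mat 1"
  shows "matrix_inv A = B"
proof -
  have "B ** A = mat 1" using assms matrix_left_right_inverse by blast
  with assms have "A ** B = mat 1 \<and> B ** A = mat 1" ..
  then have inv: "A ** matrix_inv A = mat 1 \<and> matrix_inv A ** A = mat 1"
    unfolding matrix_inv_def by (rule someI)
  have "matrix_inv A = matrix_inv A ** (A ** B)" by (simp add: assms)
  also have "\<dots> = B" by (simp add: inv matrix_mul_assoc)
  finally show ?thesis .
qed

text \<open>The transpose stays because \<open>h\<close> is arbitrary: the formula is applied to the
  disformal tensor without first showing that tensor symmetric.\<close>

lemma hodge_eq:
  "hodge h G = sqrt (- det h) *\<^sub>R dual4 (matrix_inv h ** G ** transpose (matrix_inv h))"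
proof -
  have "(\<Sum>p\<in>UNIV. \<Sum>q\<in>UNIV. e * H$c$p * H$d$q * G$p$q)
      = e * (H ** G ** transpose H) $ c $ d" for e c d and H :: mat4
  proof -
    have "(\<Sum>p\<in>UNIV. \<Sum>q\<in>UNIV. e * H$c$p * H$d$q * G$p$q)
        = (\<Sum>q\<in>UNIV. \<Sum>p\<in>UNIV. e * H$c$p * H$d$q * G$p$q)"
      by (rule sum.swap)
    also have "\<dots> = e * (H ** G ** transpose H) $ c $ d"
      by (simp add: matrix_matrix_mult_def transpose_def sum_distrib_left sum_distrib_right ac_simps)
    finally show ?thesis .
  qed
  then show ?thesis by (simp add: hodge_def dual4_def vec_eq_iff)
qed

lemma inner2_eq:
  assumes "alternating_form K"
  shows "inner2 h G K = - trace (transpose (matrix_inv h) ** G ** matrix_inv h ** K) / 2"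
proof -
  let ?H = "matrix_inv h"
  let ?t = "\<lambda>a b c d. ?H$a$c * ?H$b$d * G$a$b * K$c$d"
  have "(\<Sum>a\<in>UNIV. \<Sum>b\<in>UNIV. \<Sum>c\<in>UNIV. \<Sum>d\<in>UNIV. ?t a b c d)
      = (\<Sum>b\<in>UNIV. \<Sum>a\<in>UNIV. \<Sum>c\<in>UNIV. \<Sum>d\<in>UNIV. ?t a b c d)"
    by (rule sum.swap)
  also have "\<dots> = (\<Sum>b\<in>UNIV. \<Sum>c\<in>UNIV. \<Sum>a\<in>UNIV. \<Sum>d\<in>UNIV. ?t a b c d)"
    by (intro sum.cong refl sum.swap)
  also have "\<dots> = (\<Sum>c\<in>UNIV. \<Sum>b\<in>UNIV. \<Sum>d\<in>UNIV. \<Sum>a\<in>UNIV. ?t a b c d)"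
    by (subst sum.swap) (intro sum.cong refl sum.swap)
  also have "\<dots> = (\<Sum>c\<in>UNIV. \<Sum>d\<in>UNIV. \<Sum>b\<in>UNIV. \<Sum>a\<in>UNIV. ?t a b c d)"
    by (intro sum.cong refl sum.swap)
  also have "\<dots> = (\<Sum>c\<in>UNIV. \<Sum>d\<in>UNIV. (transpose ?H ** G ** ?H) $ c $ d * K $ c $ d)"
    by (simp add: matrix_matrix_mult_def transpose_def sum_distrib_left sum_distrib_right mult_ac)
  \<comment> \<open>A trace needs \<open>K $ d $ c\<close>; exchanging the indices of
    \<open>K\<close> costs the minus sign.\<close>
  also have "\<dots> = (\<Sum>c\<in>UNIV. \<Sum>d\<in>UNIV. - ((transpose ?H ** G ** ?H) $ c $ d * K $ d $ c))"
    using assms by (intro sum.cong refl) (metis alternating_form_def mult_minus_right)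
  also have "\<dots> = - trace (transpose ?H ** G ** ?H ** K)"
    by (simp add: trace_def matrix_matrix_mult_def[of _ K] sum_negf)
  finally show ?thesis by (simp add: inner2_def)
qed

lemma tensor_prod_eq: "tensor_prod h A B = A ** matrix_inv h ** B"
proof -
  have "(\<Sum>c\<in>UNIV. \<Sum>d\<in>UNIV. matrix_inv h $ c $ d * A $ a $ c * B $ d $ b)
      = (\<Sum>d\<in>UNIV. \<Sum>c\<in>UNIV. matrix_inv h $ c $ d * A $ a $ c * B $ d $ b)" for a b
    by (rule sum.swap)
  then show ?thesis
    by (simp add: tensor_prod_def matrix_matrix_mult_def vec_eq_iff sum_distrib_left sum_distrib_right
        mult_ac)
qed

(* The odd coefficients of the characteristic polynomial cancel; the last two terms are twice the
   second and the fourth one. *)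
lemma det_one_plus_minus:
  fixes B :: mat4
  shows "det (mat 1 + B) + det (mat 1 - B) = 2 + ((trace B)\<^sup>2 - trace (B ** B)) + 2 * det B"
  unfolding det_4 four_eq_0
  by (simp add: trace_def matrix_matrix_mult_def sum_UNIV_4 mat_def power2_eq_square algebra_simps)

text \<open>The eigenvalues are 1, 1, -1, -1. To avoid them: (1 + B)(1 - B) = 0, so an invertible
  factor would make B equal to 1 or -1, against trace 0.\<close>

lemma det_eq_1_of_traceless_involution:
  fixes B :: mat4
  assumes "B ** B = mat 1" "trace B = 0"
  shows "det B = 1"
proof -
  have neg: "\<not> invertible (mat 1 + s *\<^sub>R B)" if s: "s = 1 \<or> s = -1" for s :: real
  proof
    assume "invertible (mat 1 + s *\<^sub>R B)"
    then obtain D where D: "D ** (mat 1 + s *\<^sub>R B) = mat 1"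
      by (auto simp: invertible_def)
    have "(mat 1 + s *\<^sub>R B) ** (mat 1 - s *\<^sub>R B) = 0"
      using s assms(1)
      by (auto simp: matrix_add_rdistrib matrix_add_ldistrib matrix_sub_ldistrib
          scalar_matrix_assoc[symmetric] matrix_scalar_ac)
    then have "D ** (mat 1 + s *\<^sub>R B) ** (mat 1 - s *\<^sub>R B) = 0"
      by (simp flip: matrix_mul_assoc)
    then have "mat 1 - s *\<^sub>R B = 0" by (simp add: D)
    then have "trace (s *\<^sub>R B) = trace (mat 1 :: mat4)" by simp
    moreover have "trace (s *\<^sub>R B) = s * trace B"
      by (simp add: trace_def sum_distrib_left)
    ultimately show False using assms(2) by (simp add: trace_I)
  qed
  have "det (mat 1 + B) = 0" "det (mat 1 - B) = 0"
    using neg[of 1] neg[of "-1"] by (simp_all add: invertible_det_nz)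
  \<comment> \<open>Since \<open>trace (B ** B) = 4\<close>, the identity reads 0 = 2 - 4 + 2 det
    B.\<close>
  then show ?thesis
    using det_one_plus_minus[of B] assms by (simp add: trace_I)
qed

section \<open>Pointwise invariance of the Hodge dual\<close>

lemma lorentzian_form_det_neg:
  assumes "lorentzian_form g"
  shows "det g < 0"
proof -
  obtain P :: mat4 where "transpose P ** g ** P = minkowski"
    using assms by (auto simp: lorentzian_form_def)
  then have "det (transpose P ** g ** P) = det minkowski" by simp
  moreover have "det minkowski = -1"
    by (simp add: det_4 minkowski_def four_eq_0)
  ultimately have "(det P)\<^sup>2 * det g = -1"
    by (simp add: det_mul power2_eq_square ac_simps)
  then show ?thesis
    using mult_nonneg_nonneg[of "(det P)\<^sup>2" "det g"] by (cases "det g < 0") simp_all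
qed

lemma hodge_disformal:
  assumes g: "lorentzian_form g" and F: "alternating_form F" and reg: "inv_kappa g F \<noteq> 0"
  shows "hodge (disformal g F) F = hodge g F"
proof -
  define H where "H = matrix_inv g"
  have det: "det g < 0" using g by (rule lorentzian_form_det_neg)
  then obtain H' where H': "g ** H' = mat 1"
    using invertible_det_nz[of g] by (auto simp: invertible_def)
  then have "H = H'" unfolding H_def by (rule matrix_inv_unique)
  with H' have gH: "g ** H = mat 1" by simp
  then have Hg: "H ** g = mat 1" using matrix_left_right_inverse by blast
  have gT: "transpose g = g" using g by (simp add: lorentzian_form_def)
  have "transpose (H ** g) = mat 1" by (simp add: Hg)
  then have "g ** transpose H = mat 1" by (simp add: matrix_transpose_mul gT)
  then have HT: "transpose H = H" unfolding H_def by (metis matrix_inv_unique)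
  define X where "X = H ** F ** H"
  have X: "alternating_form X"
    unfolding X_def using alternating_form_congruence[OF F, of H] by (simp add: HT)
  \<comment> \<open>With A = \<open>H ** F\<close>, the matrix \<open>X\<close> is F with both
    indices raised and \<open>S\<close> is the square of A.\<close>
  define S where "S = X ** F"
  define \<psi> where "\<psi> = inv_psi g F"
  define k where "k = inv_kappa g F"
  have trS: "trace S = - 2 * \<psi>"
    by (simp add: \<psi>_def inv_psi_def inner2_eq[OF F] S_def X_def HT flip: H_def)
  \<comment> \<open>Lowering the indices of \<open>X\<close> is a congruence by \<open>g\<close>,
    which relates the two Pfaffians.\<close>
  have "g ** X ** g = F"
    by (simp add: X_def matrix_mul_assoc gH) (simp add: Hg flip: matrix_mul_assoc)
  then have pf: "pfaffian4 F = det g * pfaffian4 X"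
    using pfaffian4_congruence[OF X, of g] by (simp add: gT)
  have phi: "inv_phi g F = 2 * sqrt (- det g) * pfaffian4 X"
  proof -
    have "hodge g F = sqrt (- det g) *\<^sub>R dual4 X"
      by (simp add: hodge_eq HT flip: H_def X_def)
    moreover from this have "alternating_form (hodge g F)"
      by (simp add: alternating_form_def all_4 dual4_nth[OF X])
    ultimately show ?thesis
      by (simp add: inv_phi_def inner2_eq HT matrix_scalar_ac mult_dual4_self[OF X]
          trace_def mat_def flip: H_def X_def scalar_matrix_assoc)
  qed
  \<comment> \<open>Squaring the root gives \<open>- det g\<close>, and \<open>det g\<close> turns
    one Pfaffian of \<open>X\<close> into that of \<open>F\<close>.\<close>
  have "(inv_phi g F)\<^sup>2 = - 4 * (pfaffian4 X * pfaffian4 F)"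
    using det by (simp add: phi pf power_mult_distrib) (simp add: power2_eq_square)
  moreover have "4 * k\<^sup>2 = \<psi>\<^sup>2 + (inv_phi g F)\<^sup>2"
    by (simp add: k_def \<psi>_def inv_kappa_def power_divide)
  ultimately have k2: "k\<^sup>2 = \<psi>\<^sup>2 / 4 - pfaffian4 X * pfaffian4 F" by simp
  \<comment> \<open>This shift completes the square in the quadratic relation for \<open>S\<close>,
    leaving the constant \<open>k\<close> squared; it also removes the trace.\<close>
  define C where "C = S + (\<psi> / 2) *\<^sub>R mat 1"
  have SS: "S ** S = (- \<psi>) *\<^sub>R S - (pfaffian4 X * pfaffian4 F) *\<^sub>R mat 1"
    using alternating_prod_square[OF X F] unfolding S_def[symmetric] trS by simp
  have CC: "C ** C = k\<^sup>2 *\<^sub>R mat 1"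
    unfolding C_def k2
    by (simp add: matrix_add_rdistrib matrix_add_ldistrib scalar_matrix_assoc[symmetric] matrix_scalar_ac SS)
      (simp add: vec_eq_iff power2_eq_square algebra_simps)
  have trC: "trace C = 0"
    by (simp add: C_def trace_add trS) (simp add: trace_def mat_def)
  define m where "m = - inverse k"
  define B where "B = m *\<^sub>R C"
  have "m * m * k\<^sup>2 = 1"
    using reg by (simp add: m_def k_def power2_eq_square field_simps)
  then have BB: "B ** B = mat 1"
    by (simp add: B_def scalar_matrix_assoc[symmetric] matrix_scalar_ac CC)
  have trB: "trace B = 0"
    using trC by (simp add: B_def trace_def flip: sum_distrib_left)
  have detB: "det B = 1" using BB trB by (rule det_eq_1_of_traceless_involution)
  have "tensor_prod g F F = g ** S"
    by (simp add: tensor_prod_eq S_def X_def matrix_mul_assoc gH flip: H_def)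
  then have "disformal g F = m *\<^sub>R (g ** S + (\<psi> / 2) *\<^sub>R g)"
    by (simp add: disformal_def m_def flip: k_def \<psi>_def)
  also have "\<dots> = g ** B"
    by (simp add: B_def C_def matrix_add_ldistrib matrix_scalar_ac scaleR_add_right
        flip: scalar_matrix_assoc)
  finally have gB: "disformal g F = g ** B" .
  have "g ** B ** (B ** H) = g ** (B ** B) ** H" by (simp only: matrix_mul_assoc)
  then have "matrix_inv (disformal g F) = B ** H"
    by (intro matrix_inv_unique) (simp add: gB BB gH)
  moreover have "B ** H ** F ** transpose (B ** H) = X"
  proof -
    \<comment> \<open>\<open>B\<close> is a polynomial in \<open>H ** F\<close>.\<close>
    have com: "H ** F ** B = B ** (H ** F)"
      by (simp add: B_def C_def S_def X_def matrix_add_ldistrib matrix_add_rdistrib matrix_scalar_ac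
          scalar_matrix_assoc[symmetric] matrix_mul_assoc scaleR_add_right)
    have FT: "transpose F = - F" using F by (simp add: alternating_form_iff)
    have T_add: "transpose (A + A') = transpose A + transpose A'" for A A' :: mat4
      by (simp add: transpose_def vec_eq_iff)
    \<comment> \<open>\<open>B ** H\<close> combines \<open>H ** F ** H ** F ** H\<close> and
      \<open>H\<close>; the two signs from transposing \<open>F\<close> cancel.\<close>
    have BT: "transpose (B ** H) = B ** H"
      by (simp add: B_def C_def S_def X_def matrix_transpose_mul transpose_scalar T_add HT FT
          matrix_add_ldistrib matrix_add_rdistrib matrix_scalar_ac scalar_matrix_assoc[symmetric]
          matrix_mul_assoc matrix_mult_minus_left matrix_mult_minus_right)
    have "B ** H ** F ** (B ** H) = B ** (H ** F ** B) ** H" by (simp only: matrix_mul_assoc)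
    also have "\<dots> = (B ** B) ** H ** F ** H" by (simp only: com matrix_mul_assoc)
    finally show ?thesis by (simp add: BB BT X_def)
  qed
  moreover have "det (disformal g F) = det g" by (simp add: gB det_mul detB)
  ultimately show ?thesis
    by (simp add: hodge_eq X_def HT flip: H_def)
qed

section \<open>From points to exterior derivatives\<close>

text \<open>\<open>frechet_derivative\<close> is a choice among the derivatives, so functions
  agreeing near a point get the same one, differentiable or not.\<close>

lemma coord_deriv_cong:
  assumes "is_chart M c" "p \<in> chart_dom c" "\<And>q. q \<in> chart_dom c \<Longrightarrow> f q = f' q"
  shows "coord_deriv c a f p = coord_deriv c a f' p"
proof -
  have o: "open (chart_image c)" and x: "chart_map c p \<in> chart_image c"
    using assms by (auto simp: is_chart_def chart_image_def)
  have eq: "(f \<circ> chart_inv c) y = (f' \<circ> chart_inv c) y" if "y \<in> chart_image c" for y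
    using that assms(3) by (simp add: chart_image_def chart_inv_def inv_into_into)
  have "((f \<circ> chart_inv c) has_derivative D) (at (chart_map c p)) \<longleftrightarrow>
      ((f' \<circ> chart_inv c) has_derivative D) (at (chart_map c p))" for D
    using eq by (auto intro: has_derivative_transform_within_open[OF _ o x])
  then show ?thesis by (simp only: coord_deriv_def frechet_derivative_def)
qed

lemma ext_deriv_cong:
  assumes "is_chart M c" "p \<in> chart_dom c" "\<And>q. q \<in> chart_dom c \<Longrightarrow> G c q = G' c q"
  shows "ext_deriv G c p i j k = ext_deriv G' c p i j k"
  unfolding ext_deriv_def
  using assms by (intro arg_cong2[of _ _ _ _ "(+)"] coord_deriv_cong[of M]) simp_all

theorem proposition1:
  fixes M :: "'a topology" and \<A> :: "'a chart set" and g F :: "'a field2"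
  assumes "oriented_4_manifold M \<A>"
    and "lorentzian_metric \<A> g"
    and "two_form \<A> F"
    and "regular_form \<A> g F"
    and "closed_form \<A> F"
    and "closed_form \<A> (hodge_field g F)"
  shows "closed_form \<A> F \<and> closed_form \<A> (hodge_field (disformal_field g F) F)"
proof -
  have "ext_deriv (hodge_field (disformal_field g F) F) c p i j k = 0"
    if c: "c \<in> \<A>" and p: "p \<in> chart_dom c" for c p i j k
  proof -
    have "is_chart M c"
      using assms(1) c by (simp add: oriented_4_manifold_def oriented_atlas_def)
    \<comment> \<open>Agreement on the whole chart domain, an open neighbourhood of
      \<open>p\<close>, is what differentiation needs.\<close>
    moreover have "hodge_field (disformal_field g F) F c q = hodge_field g F c q"
      if "q \<in> chart_dom c" for q
      using assms(2-4) c that hodge_disformal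
      by (simp add: hodge_field_def disformal_field_def lorentzian_metric_def two_form_def
          regular_form_def)
    ultimately have "ext_deriv (hodge_field (disformal_field g F) F) c p i j k =
        ext_deriv (hodge_field g F) c p i j k"
      using p by (intro ext_deriv_cong)
    then show ?thesis using assms(6) c p by (simp add: closed_form_def)
  qed
  with assms(5) show ?thesis by (simp add: closed_form_def)
qed

end
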